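(* Let $G$ be a finite induced subgraph of the D$(3^2,4,3,4)$ lattice and let $m$ be the number of 4-vertices (vertices of degree 4) in $G$. Then $G$ is $(3m+2,m)$-total-threshold-colorable.
   Context: An edge labeling of a graph $G=(V,E)$ is a map $l:E\to\{N,F\}$. A threshold-coloring of $G$ with respect to $l$ is a map $c:V\to\mathbb{Z}$ with an integer $t\ge0$ such that for every edge $(u,v)$, $|c(u)-c(v)|\le t$ iff $l(u,v)=N$; if $m',M$ are the minimum and maximum of $c$, any integer $r>M-m'$ is a range, and $c$ is an $(r,t)$-threshold-coloring. $G$ is $(r,t)$-total-threshold-colorable if for every edge labeling there is an $(r,t)$-threshold-coloring with respect to it. The D$(3^2,4,3,4)$ lattice is the planar dual graph of the snub square tiling (the Archimedean tiling by triangles and squares with vertex species $(3,3,4,3,4)$); it is the Cairo pentagonal tiling graph, whose vertices have degree 3 or 4, with the degree-3 vertices inducing a perfect matching. *)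

theory Defs
  imports Complex_Main
begin

section \<open>Finite simple graphs and threshold-colorings\<close>

text \<open>A simple graph is a vertex set together with a set of two-element edges.\<close>

type_synonym 'a graph = "'a set \<times> 'a set set"

abbreviation verts :: "'a graph \<Rightarrow> 'a set" where "verts G \<equiv> fst G"
abbreviation edges :: "'a graph \<Rightarrow> 'a set set" where "edges G \<equiv> snd G"

definition vertex_degree :: "'a graph \<Rightarrow> 'a \<Rightarrow> nat" where
  "vertex_degree G v = card {e \<in> edges G. v \<in> e}"

definition induced_subgraph :: "'a graph \<Rightarrow> 'a graph \<Rightarrow> bool" where
  "induced_subgraph H G \<longleftrightarrow>
     verts H \<subseteq> verts G \<and> edges H = {e \<in> edges G. e \<subseteq> verts H}"

datatype label = N | F

text \<open>
  An edge labeling is a function on edges; its values outside \<open>edges G\<close> are never inspected.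
\<close>

definition threshold_coloring ::
    "'a graph \<Rightarrow> ('a set \<Rightarrow> label) \<Rightarrow> int \<Rightarrow> ('a \<Rightarrow> int) \<Rightarrow> bool" where
  "threshold_coloring G l t c \<longleftrightarrow>
     0 \<le> t \<and> (\<forall>u v. {u, v} \<in> edges G \<longrightarrow> (\<bar>c u - c v\<bar> \<le> t \<longleftrightarrow> l {u, v} = N))"

text \<open>
  The guard is needed because \<open>Max\<close> and \<open>Min\<close> are unspecified on the empty set; on the empty
  graph every \<open>r\<close> counts as a range.  Only meaningful for finite graphs.
\<close>

definition rt_threshold_coloring ::
    "'a graph \<Rightarrow> ('a set \<Rightarrow> label) \<Rightarrow> int \<Rightarrow> int \<Rightarrow> ('a \<Rightarrow> int) \<Rightarrow> bool" where
  "rt_threshold_coloring G l r t c \<longleftrightarrow>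
     threshold_coloring G l t c \<and>
     (verts G \<noteq> {} \<longrightarrow> Max (c ` verts G) - Min (c ` verts G) < r)"

definition total_threshold_colorable :: "'a graph \<Rightarrow> int \<Rightarrow> int \<Rightarrow> bool" where
  "total_threshold_colorable G r t \<longleftrightarrow> (\<forall>l. \<exists>c. rt_threshold_coloring G l r t c)"

section \<open>The snub square tiling and its planar dual\<close>

text \<open>
  Vertices of the snub square tiling are indexed by \<open>int \<times> int\<close>.  Combinatorially the tiling is the
  square grid in which the cells with lower left corner \<open>(i, j)\<close>, \<open>i + j\<close> even, are cut into two
  triangles by a diagonal: the rising one if \<open>i\<close> is even, the falling one if \<open>i\<close> is odd.
  The cells with \<open>i + j\<close> odd are the square tiles.  A tile is represented by its set of corners.
  The lemmas below confirm this: \<open>snub_pos\<close> draws the tiling in the plane with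
  regular tiles of side length 1, and every vertex has species (3,3,4,3,4).
\<close>

definition square_cell :: "int \<Rightarrow> int \<Rightarrow> (int \<times> int) set" where
  "square_cell i j = {(i, j), (i + 1, j), (i + 1, j + 1), (i, j + 1)}"

definition square_tiles :: "(int \<times> int) set set" where
  "square_tiles = {square_cell i j |i j. odd (i + j)}"

definition triangle_tiles :: "(int \<times> int) set set" where
  "triangle_tiles =
     {{(i, j), (i + 1, j), (i + 1, j + 1)} |i j. even i \<and> even j} \<union>
     {{(i, j), (i, j + 1), (i + 1, j + 1)} |i j. even i \<and> even j} \<union>
     {{(i, j), (i + 1, j), (i, j + 1)} |i j. odd i \<and> odd j} \<union>
     {{(i + 1, j), (i, j + 1), (i + 1, j + 1)} |i j. odd i \<and> odd j}"

definition snub_tiles :: "(int \<times> int) set set" where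
  "snub_tiles = square_tiles \<union> triangle_tiles"

definition snub_edges :: "(int \<times> int) set set" where
  "snub_edges =
     {{(i, j), (i + 1, j)} |i j. True} \<union>
     {{(i, j), (i, j + 1)} |i j. True} \<union>
     {{(i, j), (i + 1, j + 1)} |i j. even i \<and> even j} \<union>
     {{(i + 1, j), (i, j + 1)} |i j. odd i \<and> odd j}"

text \<open>
  In the planar dual two tiles are adjacent iff they share a side.  An edge whose ends are both
  corners of a tile is a side of it, since the diagonals of the square tiles are not edges.
\<close>

definition dual_graph :: "'a set set \<Rightarrow> 'a set set \<Rightarrow> 'a set graph" where
  "dual_graph E T =
     (T, {{A, B} |A B. A \<in> T \<and> B \<in> T \<and> A \<noteq> B \<and> (\<exists>e\<in>E. e \<subseteq> A \<and> e \<subseteq> B)})"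

text \<open>The D\<open>(3\<^sup>2,4,3,4)\<close> lattice, i.e. the Cairo pentagonal tiling graph.\<close>

definition cairo_lattice :: "(int \<times> int) set graph" where
  "cairo_lattice = dual_graph snub_edges snub_tiles"

subsection \<open>The combinatorial model is the snub square tiling\<close>

definition snub_pos :: "int \<times> int \<Rightarrow> complex" where
  "snub_pos = (\<lambda>(i, j).
     Complex (cos (pi/12) * of_int i - sin (pi/12) * of_int (j mod 2))
             (cos (pi/12) * of_int j - sin (pi/12) * of_int (i mod 2)))"

lemma cos_sin_pi_12:
  "(cos (pi/12) - sin (pi/12)) * (cos (pi/12) - sin (pi/12)) = (1/2::real)"
proof -
  have "cos (pi/12) * sin (pi/12) = (1/4::real)"
    using sin_double[of "pi/12"] sin_30 by (simp add: mult.commute)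
  then show ?thesis
    using sin_cos_squared_add3[of "pi/12"]
    by (simp add: algebra_simps del: sin_cos_squared_add3)
qed

lemma cmod_1I: "Re z * Re z + Im z * Im z = 1 \<Longrightarrow> cmod z = 1"
  by (simp add: cmod_def power2_eq_square)

lemma cmod_Complex_diag:
  assumes "x * x = 1/2"
  shows "cmod (Complex x x) = 1" "cmod (Complex x (- x)) = 1"
  using assms by (auto intro!: cmod_1I)

lemma snub_edge_length:
  assumes "{u, v} \<in> snub_edges"
  shows "dist (snub_pos u) (snub_pos v) = 1"
proof -
  have m: "(i mod 2 = 0 \<and> (i + 1) mod 2 = 1) \<or> (i mod 2 = 1 \<and> (i + 1) mod 2 = 0)" for i :: int
    by presburger
  note defs = dist_norm snub_pos_def
  have h: "dist (snub_pos (i, j)) (snub_pos (i + 1, j)) = 1" for i j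
    unfolding defs using m[of i]
    by (intro cmod_1I) (elim disjE conjE; simp add: ring_distribs)
  have v: "dist (snub_pos (i, j)) (snub_pos (i, j + 1)) = 1" for i j
    unfolding defs using m[of j]
    by (intro cmod_1I) (elim disjE conjE; simp add: ring_distribs add.commute)
  have d1: "dist (snub_pos (i, j)) (snub_pos (i + 1, j + 1)) = 1" if "even i" "even j" for i j
  proof -
    have "i mod 2 = 0" "j mod 2 = 0" "(i + 1) mod 2 = 1" "(j + 1) mod 2 = 1"
      using that by presburger+
    then have "snub_pos (i, j) - snub_pos (i + 1, j + 1) =
        - Complex (cos (pi/12) - sin (pi/12)) (cos (pi/12) - sin (pi/12))"
      by (simp add: snub_pos_def complex_eq_iff ring_distribs)
    then show ?thesis
      using cmod_Complex_diag(1)[OF cos_sin_pi_12] by (simp only: dist_norm norm_minus_cancel)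
  qed
  have d2: "dist (snub_pos (i + 1, j)) (snub_pos (i, j + 1)) = 1" if "odd i" "odd j" for i j
  proof -
    have "i mod 2 = 1" "j mod 2 = 1" "(i + 1) mod 2 = 0" "(j + 1) mod 2 = 0"
      using that by presburger+
    then have "snub_pos (i + 1, j) - snub_pos (i, j + 1) =
        Complex (cos (pi/12) - sin (pi/12)) (- (cos (pi/12) - sin (pi/12)))"
      by (simp add: snub_pos_def complex_eq_iff ring_distribs)
    then show ?thesis
      using cmod_Complex_diag(2)[OF cos_sin_pi_12] by (simp only: dist_norm)
  qed
  show ?thesis
    using assms unfolding snub_edges_def
    by (elim UnE CollectE exE conjE; simp only: doubleton_eq_iff; elim disjE conjE;
        use h v d1 d2 in \<open>simp add: dist_commute\<close>)
qed

text \<open>Square tiles are drawn with a right angle (their sides have length 1 by the previous lemma).\<close>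

lemma snub_square_right_angle:
  assumes "odd (i + j)"
  shows "snub_pos (i, j + 1) - snub_pos (i, j) = \<i> * (snub_pos (i + 1, j) - snub_pos (i, j))"
    and "snub_pos (i + 1, j + 1) - snub_pos (i, j + 1) = snub_pos (i + 1, j) - snub_pos (i, j)"
proof -
  have "(i + 1) mod 2 = 1 - i mod 2" "(j + 1) mod 2 = 1 - j mod 2"
    "(i mod 2 = 0 \<and> j mod 2 = 1) \<or> (i mod 2 = 1 \<and> j mod 2 = 0)"
    using assms by presburger+
  then show "snub_pos (i, j + 1) - snub_pos (i, j) = \<i> * (snub_pos (i + 1, j) - snub_pos (i, j))"
    and "snub_pos (i + 1, j + 1) - snub_pos (i, j + 1) = snub_pos (i + 1, j) - snub_pos (i, j)"
    by (auto simp: snub_pos_def complex_eq_iff algebra_simps)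
qed

text \<open>The tiles around a vertex, listed in cyclic order.\<close>

definition vertex_species_33434 :: "int \<times> int \<Rightarrow> bool" where
  "vertex_species_33434 v \<longleftrightarrow> (\<exists>A B C D E.
     {T \<in> snub_tiles. v \<in> T} = {A, B, C, D, E} \<and>
     distinct [A, B, C, D, E] \<and> map card [A, B, C, D, E] = [3, 3, 4, 3, 4] \<and>
     (\<forall>(X, Y) \<in> set [(A, B), (B, C), (C, D), (D, E), (E, A)].
        \<exists>e\<in>snub_edges. v \<in> e \<and> e \<subseteq> X \<and> e \<subseteq> Y))"

lemma snub_tile_cases [consumes 1]:
  assumes "T \<in> snub_tiles"
  obtains x y where "odd (x + y)" "T = {(x, y), (x + 1, y), (x + 1, y + 1), (x, y + 1)}"
  | x y where "even x" "even y" "T = {(x, y), (x + 1, y), (x + 1, y + 1)}"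
  | x y where "even x" "even y" "T = {(x, y), (x, y + 1), (x + 1, y + 1)}"
  | x y where "odd x" "odd y" "T = {(x, y), (x + 1, y), (x, y + 1)}"
  | x y where "odd x" "odd y" "T = {(x + 1, y), (x, y + 1), (x + 1, y + 1)}"
  using assms unfolding snub_tiles_def square_tiles_def triangle_tiles_def square_cell_def
  by (elim UnE CollectE exE conjE) (erule (2) that | erule (1) that)+

lemma snub_tileI:
  "odd (x + y) \<Longrightarrow> {(x, y), (x + 1, y), (x + 1, y + 1), (x, y + 1)} \<in> snub_tiles"
  "even x \<Longrightarrow> even y \<Longrightarrow> {(x, y), (x + 1, y), (x + 1, y + 1)} \<in> snub_tiles"
  "even x \<Longrightarrow> even y \<Longrightarrow> {(x, y), (x, y + 1), (x + 1, y + 1)} \<in> snub_tiles"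
  "odd x \<Longrightarrow> odd y \<Longrightarrow> {(x, y), (x + 1, y), (x, y + 1)} \<in> snub_tiles"
  "odd x \<Longrightarrow> odd y \<Longrightarrow> {(x + 1, y), (x, y + 1), (x + 1, y + 1)} \<in> snub_tiles"
  unfolding snub_tiles_def square_tiles_def triangle_tiles_def square_cell_def by blast+

lemma snub_edgeI:
  "{(x, y), (x + 1, y)} \<in> snub_edges"
  "{(x, y), (x, y + 1)} \<in> snub_edges"
  "even x \<Longrightarrow> even y \<Longrightarrow> {(x, y), (x + 1, y + 1)} \<in> snub_edges"
  "odd x \<Longrightarrow> odd y \<Longrightarrow> {(x + 1, y), (x, y + 1)} \<in> snub_edges"
  unfolding snub_edges_def by blast+

lemma vertex_species_33434I:
  assumes "\<And>T. T \<in> snub_tiles \<Longrightarrow> v \<in> T \<Longrightarrow> T = A \<or> T = B \<or> T = C \<or> T = D \<or> T = E"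
    and "A \<in> snub_tiles" "B \<in> snub_tiles" "C \<in> snub_tiles" "D \<in> snub_tiles" "E \<in> snub_tiles"
    and "{v, a} \<in> snub_edges" "{v, b} \<in> snub_edges" "{v, c} \<in> snub_edges"
      "{v, d} \<in> snub_edges" "{v, e} \<in> snub_edges"
    and "{v, a} \<subseteq> A \<inter> B" "{v, b} \<subseteq> B \<inter> C" "{v, c} \<subseteq> C \<inter> D" "{v, d} \<subseteq> D \<inter> E" "{v, e} \<subseteq> E \<inter> A"
    and "A \<noteq> B" "A \<noteq> D" "B \<noteq> D" "C \<noteq> E"
    and "card A = 3" "card B = 3" "card C = 4" "card D = 3" "card E = 4"
  shows "vertex_species_33434 v"
proof -
  have "{T \<in> snub_tiles. v \<in> T} = {A, B, C, D, E}"
  proof (intro equalityI subsetI)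
    show "T \<in> {A, B, C, D, E}" if "T \<in> {T \<in> snub_tiles. v \<in> T}" for T
      using assms(1)[of T] that by simp
    have "v \<in> A" "v \<in> B" "v \<in> C" "v \<in> D" "v \<in> E"
      using assms(12-16) by simp_all
    then show "T \<in> {T \<in> snub_tiles. v \<in> T}" if "T \<in> {A, B, C, D, E}" for T
      using assms(2-6) that by (elim insertE; simp)
  qed
  moreover have "distinct [A, B, C, D, E]"
    using assms(17-) by auto
  moreover have "\<exists>e\<in>snub_edges. v \<in> e \<and> e \<subseteq> A \<and> e \<subseteq> B"
    using assms(7,12) by (intro bexI[of _ "{v, a}"]) simp_all
  moreover have "\<exists>e\<in>snub_edges. v \<in> e \<and> e \<subseteq> B \<and> e \<subseteq> C"
    using assms(8,13) by (intro bexI[of _ "{v, b}"]) simp_all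
  moreover have "\<exists>e\<in>snub_edges. v \<in> e \<and> e \<subseteq> C \<and> e \<subseteq> D"
    using assms(9,14) by (intro bexI[of _ "{v, c}"]) simp_all
  moreover have "\<exists>e\<in>snub_edges. v \<in> e \<and> e \<subseteq> D \<and> e \<subseteq> E"
    using assms(10,15) by (intro bexI[of _ "{v, d}"]) simp_all
  moreover have "\<exists>e\<in>snub_edges. v \<in> e \<and> e \<subseteq> E \<and> e \<subseteq> A"
    using assms(11,16) by (intro bexI[of _ "{v, e}"]) simp_all
  ultimately show ?thesis
    unfolding vertex_species_33434_def using assms(21-)
    by (intro exI[of _ A] exI[of _ B] exI[of _ C] exI[of _ D] exI[of _ E]) simp
qed

lemma snub_vertex_species: "vertex_species_33434 (i, j)"
proof -
  note edge = snub_edgeI[of i j] snub_edgeI[of "i - 1" j] snub_edgeI[of i "j - 1"]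
    snub_edgeI[of "i - 1" "j - 1"]
  note tile = snub_tileI[of i j] snub_tileI[of "i - 1" j] snub_tileI[of i "j - 1"]
    snub_tileI[of "i - 1" "j - 1"]
  consider "even i" "even j" | "odd i" "odd j" | "odd i" "even j" | "even i" "odd j"
    by blast
  then show ?thesis
  proof cases
    case 1
    let ?A = "{(i, j), (i + 1, j), (i + 1, j + 1)}"
    let ?B = "{(i, j), (i, j + 1), (i + 1, j + 1)}"
    let ?C = "{(i - 1, j), (i, j), (i, j + 1), (i - 1, j + 1)}"
    let ?D = "{(i, j - 1), (i - 1, j), (i, j)}"
    let ?E = "{(i, j - 1), (i + 1, j - 1), (i + 1, j), (i, j)}"
    show ?thesis
    proof (rule vertex_species_33434I[of _ ?A ?B ?C ?D ?E
          "(i + 1, j + 1)" "(i, j + 1)" "(i - 1, j)" "(i, j - 1)" "(i + 1, j)"])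
      show "T = ?A \<or> T = ?B \<or> T = ?C \<or> T = ?D \<or> T = ?E"
        if "T \<in> snub_tiles" "(i, j) \<in> T" for T
        using that(1)
        by (cases rule: snub_tile_cases)
          (use that(2) 1 in \<open>simp; elim disjE conjE; simp\<close>)+
    qed (use edge tile 1 in \<open>simp_all add: insert_commute set_eq_subset\<close>)
  next
    case 2
    let ?A = "{(i - 1, j - 1), (i, j - 1), (i, j)}"
    let ?B = "{(i - 1, j - 1), (i - 1, j), (i, j)}"
    let ?C = "{(i - 1, j), (i, j), (i, j + 1), (i - 1, j + 1)}"
    let ?D = "{(i, j), (i + 1, j), (i, j + 1)}"
    let ?E = "{(i, j - 1), (i + 1, j - 1), (i + 1, j), (i, j)}"
    show ?thesis
    proof (rule vertex_species_33434I[of _ ?A ?B ?C ?D ?E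
          "(i - 1, j - 1)" "(i - 1, j)" "(i, j + 1)" "(i + 1, j)" "(i, j - 1)"])
      show "T = ?A \<or> T = ?B \<or> T = ?C \<or> T = ?D \<or> T = ?E"
        if "T \<in> snub_tiles" "(i, j) \<in> T" for T
        using that(1)
        by (cases rule: snub_tile_cases)
          (use that(2) 2 in \<open>simp; elim disjE conjE; simp\<close>)+
    qed (use edge tile 2 in \<open>simp_all add: insert_commute set_eq_subset\<close>)
  next
    case 3
    let ?A = "{(i, j - 1), (i + 1, j - 1), (i, j)}"
    let ?B = "{(i + 1, j - 1), (i, j), (i + 1, j)}"
    let ?C = "{(i, j), (i + 1, j), (i + 1, j + 1), (i, j + 1)}"
    let ?D = "{(i - 1, j), (i, j), (i, j + 1)}"
    let ?E = "{(i - 1, j - 1), (i, j - 1), (i, j), (i - 1, j)}"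
    show ?thesis
    proof (rule vertex_species_33434I[of _ ?A ?B ?C ?D ?E
          "(i + 1, j - 1)" "(i + 1, j)" "(i, j + 1)" "(i - 1, j)" "(i, j - 1)"])
      show "T = ?A \<or> T = ?B \<or> T = ?C \<or> T = ?D \<or> T = ?E"
        if "T \<in> snub_tiles" "(i, j) \<in> T" for T
        using that(1)
        by (cases rule: snub_tile_cases)
          (use that(2) 3 in \<open>simp; elim disjE conjE; simp\<close>)+
    qed (use edge tile 3 in \<open>simp_all add: insert_commute set_eq_subset\<close>)
  next
    case 4
    let ?A = "{(i - 1, j), (i, j), (i - 1, j + 1)}"
    let ?B = "{(i, j), (i - 1, j + 1), (i, j + 1)}"
    let ?C = "{(i, j), (i + 1, j), (i + 1, j + 1), (i, j + 1)}"
    let ?D = "{(i, j - 1), (i, j), (i + 1, j)}"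
    let ?E = "{(i - 1, j - 1), (i, j - 1), (i, j), (i - 1, j)}"
    show ?thesis
    proof (rule vertex_species_33434I[of _ ?A ?B ?C ?D ?E
          "(i - 1, j + 1)" "(i, j + 1)" "(i + 1, j)" "(i, j - 1)" "(i - 1, j)"])
      show "T = ?A \<or> T = ?B \<or> T = ?C \<or> T = ?D \<or> T = ?E"
        if "T \<in> snub_tiles" "(i, j) \<in> T" for T
        using that(1)
        by (cases rule: snub_tile_cases)
          (use that(2) 4 in \<open>simp; elim disjE conjE; simp\<close>)+
    qed (use edge tile 4 in \<open>simp_all add: insert_commute set_eq_subset\<close>)
  qed
qed

end

theory Submission
  imports Defs
begin

text \<open>
  The 4-vertices are the square tiles, and two triangles sharing a side form a rhombus.  Give the
  squares colors in \<open>{m+1..2m}\<close>.  A triangle whose square neighbors both carry label \<open>N\<close> may then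
  take any color in \<open>{m..2m+1}\<close>, and one with two labels \<open>F\<close> may take \<open>0\<close> and \<open>3m+1\<close>; in both cases
  the edge to the other triangle can always be satisfied.  A triangle with mixed labels gets a color
  in \<open>{1..m}\<close> or in \<open>{2m+1..3m}\<close>, depending on which of its two squares has the smaller color.
  So the only obstruction comes from two mixed triangles in one rhombus, and it amounts to a
  parity condition relating the orders of the colors of their squares.

  Turned by 45 degrees, the squares form a grid whose faces are the rhombi.  The parity conditions
  couple the bottom and top sides of the black faces, and the left and right sides of the white faces
  of a checkerboard; they have to be met by an acyclic orientation of the grid.
  Within each even row, make every second vertex a source or a sink.  This forces the coupled
  sides, and the choices in one row can be made successively so that the vertices between them
  become sources or sinks with respect to the odd rows.  What remains are the odd rows themselves,
  which are disjoint paths.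
\<close>

section \<open>Potentials on the square grid with prescribed parity conditions\<close>

lemma int_antidifference:
  fixes d :: "int \<Rightarrow> int"
  obtains g where "\<And>x. g (x + 1) = g x + d x"
proof
  fix x :: int
  \<comment> \<open>One of the two sums is always empty; the second continues the partial sums to
    negative arguments.\<close>
  let ?g = "\<lambda>x. sum d {0..<x} - sum d {x..<0}"
  show "?g (x + 1) = ?g x + d x"
  proof (cases "0 \<le> x")
    case True
    then have "{0..<x + 1} = insert x {0..<x}" by auto
    with True show ?thesis by simp
  next
    case False
    then have "{x..<0} = insert x {x + 1..<0}" by auto
    with False show ?thesis by simp
  qed
qed

lemma bool_antidifference:
  fixes d :: "int \<Rightarrow> bool"
  obtains s where "\<And>x. s (x + 1) \<longleftrightarrow> s x = d x"
proof -
  \<comment> \<open>\<open>s\<close> is the parity of a counter that moves by one exactly where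
    \<open>d\<close> fails.\<close>
  obtain g :: "int \<Rightarrow> int" where g: "\<And>x. g (x + 1) = g x + (if d x then 0 else 1)"
    using int_antidifference[of "\<lambda>x. if d x then 0 else 1"] by metis
  have "even (g (x + 1)) \<longleftrightarrow> even (g x) = d x" for x
    by (simp add: g)
  then show thesis by (rule that)
qed

text \<open>A path has no cycle, so every orientation of its edges comes from a potential. This will
  serve the odd rows.\<close>

lemma walk_with_given_steps:
  fixes d :: "int \<Rightarrow> bool"
  obtains g :: "int \<Rightarrow> int"
    where "\<And>x. g x \<noteq> g (x + 1)" "\<And>x. g x < g (x + 1) \<longleftrightarrow> d x"
proof -
  obtain g :: "int \<Rightarrow> int" where g: "\<And>x. g (x + 1) = g x + (if d x then 1 else - 1)"
    using int_antidifference[of "\<lambda>x. if d x then 1 else - 1"] by metis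
  show thesis by (rule that[of g]) (simp_all add: g)
qed

lemma grid_potential:
  fixes \<sigma> :: "int \<Rightarrow> int \<Rightarrow> bool"
  obtains K :: "int \<Rightarrow> int \<Rightarrow> real" where
    "\<And>x y. K x y \<noteq> K (x + 1) y"
    "\<And>x y. K x y \<noteq> K x (y + 1)"
    "\<And>x y. even (x + y) \<Longrightarrow>
       K x y < K (x + 1) y \<longleftrightarrow> (K x (y + 1) < K (x + 1) (y + 1)) = \<sigma> x y"
    "\<And>x y. odd (x + y) \<Longrightarrow>
       K x y < K x (y + 1) \<longleftrightarrow> (K (x + 1) y < K (x + 1) (y + 1)) = \<sigma> x y"
proof -
  \<comment> \<open>For even \<open>y\<close>, \<open>L y x\<close> says that the vertex lies below
    the odd rows, so it decides both of its vertical edges. Between columns \<open>x\<close> and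
    \<open>x + 1\<close> exactly one white face touches row \<open>y\<close>, from below if
    \<open>x\<close> is even and from above if \<open>x\<close> is odd. Its condition determines
    \<open>L y (x + 1)\<close> from \<open>L y x\<close>.\<close>
  have "\<exists>s. \<forall>x. s (x + 1) \<longleftrightarrow> s x = (if even x then \<sigma> x (y - 1) else \<sigma> x y)" for y
    using bool_antidifference[of "\<lambda>x. if even x then \<sigma> x (y - 1) else \<sigma> x y"] by metis
  then obtain L where
    L: "\<And>y x. L y (x + 1) \<longleftrightarrow> L y x = (if even x then \<sigma> x (y - 1) else \<sigma> x y)"
    by metis
  \<comment> \<open>For odd \<open>y\<close>, each horizontal edge of the row lies on exactly one
    black face, whose opposite side is in row \<open>y - 1\<close> for even \<open>x\<close> and in
    row \<open>y + 1\<close> for odd \<open>x\<close>. That side is oriented by \<open>L\<close>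
    already, so the condition prescribes the step of \<open>g\<close>.\<close>
  have "\<exists>g::int \<Rightarrow> int. \<forall>x. g x \<noteq> g (x + 1) \<and> (g x < g (x + 1) \<longleftrightarrow>
      (if even x then L (y - 1) x = \<sigma> x (y - 1) else (\<not> L (y + 1) (x + 1)) = \<sigma> x y))" for y
    by (rule walk_with_given_steps[of "\<lambda>x. if even x then L (y - 1) x = \<sigma> x (y - 1)
        else (\<not> L (y + 1) (x + 1)) = \<sigma> x y"]) metis
  then obtain g :: "int \<Rightarrow> int \<Rightarrow> int" where
    g: "\<And>y x. g y x \<noteq> g y (x + 1)"
       "\<And>y x. g y x < g y (x + 1) \<longleftrightarrow>
         (if even x then L (y - 1) x = \<sigma> x (y - 1) else (\<not> L (y + 1) (x + 1)) = \<sigma> x y)"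
    by metis
  \<comment> \<open>The values \<open>\<plusminus>3\<close> and \<open>\<plusminus>2\<close> of the even rows lie outside the range of \<open>arctan\<close>, so every vertex
    of an even row is a source or a sink with respect to the odd rows.\<close>
  define K :: "int \<Rightarrow> int \<Rightarrow> real" where
    "K x y = (if odd y then arctan (g y x)
      else (if L y x then - 1 else 1) * (if even x then 3 else 2))" for x y
  have odd_row: "K x y = arctan (g y x)" if "odd y" for x y
    using that by (simp add: K_def)
  have even_row: "K x y = (if L y x then - 1 else 1) * (if even x then 3 else 2)" if "even y" for x y
    using that by (simp add: K_def)
  have bounds: "- 2 < arctan z" "arctan z < 2" for z
    using arctan_bounded[of z] pi_less_4 by linarith+
  have cmp: "arctan z < (if b then - 1 else 1) * (if e then 3 else 2) \<longleftrightarrow> \<not> b"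
      "(if b then - 1 else 1) * (if e then 3 else 2) < arctan z \<longleftrightarrow> b"
      "arctan z \<noteq> (if b then - 1 else 1) * (if e then 3 else 2)"
      "(if b then - 1 else 1) * (if e then 3 else 2) \<noteq> arctan z" for z b e
    using bounds[of z] by auto
  \<comment> \<open>The end in an even column has absolute value 3 against 2, so its sign alone
    decides the comparison.\<close>
  have row: "(if b then - 1 else 1) * (if even x then 3 else 2)
        \<noteq> (if b' then - 1 else 1) * (if even (x + 1) then 3 else 2 :: real)"
      "(if b then - 1 else 1) * (if even x then 3 else 2)
        < (if b' then - 1 else 1) * (if even (x + 1) then 3 else 2 :: real)
        \<longleftrightarrow> (if even x then b else \<not> b')" for b b' and x :: int
    by auto
  show thesis
  proof (rule that)
    fix x y
    show "K x y \<noteq> K (x + 1) y"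
    proof (cases "even y")
      case True
      then show ?thesis by (simp only: even_row row not_False_eq_True)
    next
      case False
      then show ?thesis by (simp add: odd_row arctan_eq_iff g)
    qed
    show "K x y \<noteq> K x (y + 1)"
    proof (cases "even y")
      case True
      then have "odd (y + 1)" by simp
      with True show ?thesis by (simp only: even_row odd_row cmp not_False_eq_True)
    next
      case False
      then have "even (y + 1)" by simp
      with False show ?thesis by (simp only: even_row odd_row cmp not_False_eq_True)
    qed
  next
    fix x y :: int
    assume xy: "even (x + y)"
    show "K x y < K (x + 1) y \<longleftrightarrow> (K x (y + 1) < K (x + 1) (y + 1)) = \<sigma> x y"
    proof (cases "even y")
      case True
      then have p: "odd (y + 1)" "even x" using xy by simp_all
      have "K x y < K (x + 1) y \<longleftrightarrow> (if even x then L y x else \<not> L y (x + 1))"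
        by (simp only: even_row[OF True] row)
      moreover have "K x (y + 1) < K (x + 1) (y + 1) \<longleftrightarrow> (L y x = \<sigma> x y)"
        using g(2)[of "y + 1" x] p by (simp add: odd_row arctan_less_iff)
      ultimately show ?thesis using p by auto
    next
      case False
      then have p: "even (y + 1)" "odd x" using xy by simp_all
      have "K x (y + 1) < K (x + 1) (y + 1) \<longleftrightarrow>
          (if even x then L (y + 1) x else \<not> L (y + 1) (x + 1))"
        by (simp only: even_row[OF p(1)] row)
      moreover have "K x y < K (x + 1) y \<longleftrightarrow> ((\<not> L (y + 1) (x + 1)) = \<sigma> x y)"
        using g(2)[of y x] p False by (simp add: odd_row arctan_less_iff)
      ultimately show ?thesis using p by auto
    qed
  next
    fix x y :: int
    assume xy: "odd (x + y)"
    show "K x y < K x (y + 1) \<longleftrightarrow> (K (x + 1) y < K (x + 1) (y + 1)) = \<sigma> x y"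
    proof (cases "even y")
      case True
      then have p: "odd (y + 1)" "odd x" using xy by simp_all
      have "K x' y < K x' (y + 1) \<longleftrightarrow> L y x'" for x'
        by (simp only: even_row[OF True] odd_row[OF p(1)] cmp)
      then show ?thesis using L[of y x] p by auto
    next
      case False
      then have p: "even (y + 1)" "even x" using xy by simp_all
      have "K x' y < K x' (y + 1) \<longleftrightarrow> \<not> L (y + 1) x'" for x'
        by (simp only: even_row[OF p(1)] odd_row[OF False] cmp)
      then show ?thesis using L[of "y + 1" x] p by auto
    qed
  qed
qed

text \<open>
  The lower triangle of the rhombus at \<open>(i, j)\<close> is adjacent to the squares at \<open>(i, j - 1)\<close> and
  \<open>(i + turn i, j)\<close>, the upper one to those at \<open>(i - turn i, j)\<close> and \<open>(i, j + 1)\<close>.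
\<close>

definition turn :: "int \<Rightarrow> int" where
  "turn i = (if even i then 1 else - 1)"

text \<open>This is \<open>grid_potential\<close> turned by 45 degrees. The face with lower left
  corner \<open>(x, y)\<close> becomes the rhombus at \<open>(x - y, x + y + 2)\<close>. It is black
  for even \<open>i\<close>, where \<open>turn\<close> pairs the squares into bottom and top, and
  white for odd \<open>i\<close>, where they are paired into left and right.\<close>

lemma square_potential:
  fixes \<sigma> :: "int \<Rightarrow> int \<Rightarrow> bool"
  obtains k :: "int \<times> int \<Rightarrow> real" where
    "\<And>i j. even (i + j) \<Longrightarrow> k (i, j - 1) \<noteq> k (i + turn i, j)"
    "\<And>i j. even (i + j) \<Longrightarrow> k (i - turn i, j) \<noteq> k (i, j + 1)"
    "\<And>i j. even (i + j) \<Longrightarrow> k (i, j - 1) < k (i + turn i, j) \<longleftrightarrow>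
       (k (i - turn i, j) < k (i, j + 1)) = \<sigma> i j"
proof -
  obtain K :: "int \<Rightarrow> int \<Rightarrow> real" where K:
    "\<And>x y. K x y \<noteq> K (x + 1) y"
    "\<And>x y. K x y \<noteq> K x (y + 1)"
    "\<And>x y. even (x + y) \<Longrightarrow>
       K x y < K (x + 1) y \<longleftrightarrow> (K x (y + 1) < K (x + 1) (y + 1)) = \<sigma> (x - y) (x + y + 2)"
    "\<And>x y. odd (x + y) \<Longrightarrow>
       K x y < K x (y + 1) \<longleftrightarrow> (K (x + 1) y < K (x + 1) (y + 1)) = \<sigma> (x - y) (x + y + 2)"
    using grid_potential[of "\<lambda>x y. \<sigma> (x - y) (x + y + 2)"] by blast
  \<comment> \<open>The square at \<open>(p, q)\<close> is the grid point \<open>(x, y)\<close> with \<open>p + q = 2 x + 1\<close>, \<open>q - p = 2 y + 1\<close>.\<close>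
  define k where "k = (\<lambda>(p, q). K ((p + q - 1) div 2) ((q - p - 1) div 2))"
  have corners: "k (i, j - 1) = K x y" "k (i + 1, j) = K (x + 1) y"
      "k (i - 1, j) = K x (y + 1)" "k (i, j + 1) = K (x + 1) (y + 1)"
    if "i = x - y" "j = x + y + 2" for i j x y
  proof -
    have "(i + (j - 1) - 1) div 2 = x" "(j - 1 - i - 1) div 2 = y"
      "(i + 1 + j - 1) div 2 = x + 1" "(j - (i + 1) - 1) div 2 = y"
      "(i - 1 + j - 1) div 2 = x" "(j - (i - 1) - 1) div 2 = y + 1"
      "(i + (j + 1) - 1) div 2 = x + 1" "(j + 1 - i - 1) div 2 = y + 1"
      using that by presburger+
    then show "k (i, j - 1) = K x y" "k (i + 1, j) = K (x + 1) y"
      "k (i - 1, j) = K x (y + 1)" "k (i, j + 1) = K (x + 1) (y + 1)"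
      unfolding k_def by simp_all
  qed
  have "k (i, j - 1) \<noteq> k (i + turn i, j) \<and> k (i - turn i, j) \<noteq> k (i, j + 1) \<and>
      (k (i, j - 1) < k (i + turn i, j) \<longleftrightarrow> (k (i - turn i, j) < k (i, j + 1)) = \<sigma> i j)"
    if "even (i + j)" for i j
  proof -
    define x y where "x = (i + j) div 2 - 1" and "y = (j - i) div 2 - 1"
    have ij: "i = x - y" "j = x + y + 2"
      unfolding x_def y_def using that by presburger+
    note corners = corners[OF ij]
    show ?thesis
    proof (cases "even i")
      case True
      then have "even (x + y)" using ij by presburger
      then show ?thesis
        using K(1)[of x y] K(1)[of x "y + 1"] K(3)[of x y] True
        by (simp add: turn_def corners ij[symmetric])
    next
      case False
      then have "odd (x + y)" using ij by presburger
      then show ?thesis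
        using K(2)[of x y] K(2)[of "x + 1" y] K(4)[of x y] False
        by (simp add: turn_def corners ij[symmetric])
    qed
  qed
  then show thesis by (intro that[of k]) blast+
qed

section \<open>Tiles and edges of the lattice\<close>

text \<open>\<open>lower\<close> and \<open>upper\<close> are the halves of a cut cell that contain
  its bottom and its top side. The parity test covers rising and falling diagonals at once.\<close>

definition lower :: "int \<Rightarrow> int \<Rightarrow> (int \<times> int) set" where
  "lower i j = {(i, j), (i + 1, j), (if even i then i + 1 else i, j + 1)}"

definition upper :: "int \<Rightarrow> int \<Rightarrow> (int \<times> int) set" where
  "upper i j = {(if even i then i else i + 1, j), (i, j + 1), (i + 1, j + 1)}"

text \<open>An invariant that recovers the cell of a tile. Distinct tiles with the same value can
  only be the two triangles of one rhombus.\<close>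

definition corner :: "(int \<times> int) set \<Rightarrow> int \<times> int" where
  "corner A = (Min (fst ` A), Min (snd ` A))"

lemma corner_simps [simp]:
  "corner (square_cell i j) = (i, j)"
  "corner (lower i j) = (i, j)"
  "corner (upper i j) = (i, j)"
  by (simp_all add: corner_def square_cell_def lower_def upper_def)

lemma lower_neq_upper: "lower i j \<noteq> upper i j"
proof -
  have "(if even i then i + 1 else i, j) \<in> lower i j - upper i j"
    by (auto simp: lower_def upper_def)
  then show ?thesis by blast
qed

lemma snub_tiles_shape_cases:
  assumes "T \<in> snub_tiles"
  obtains (square) i j where "odd (i + j)" "T = square_cell i j"
  | (lower) i j where "even (i + j)" "T = lower i j"
  | (upper) i j where "even (i + j)" "T = upper i j"
  using assms
proof (cases rule: snub_tile_cases)
  case (1 x y)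
  then show ?thesis using square by (simp add: square_cell_def)
next
  case (2 x y)
  then show ?thesis using lower[of x y] by (simp add: lower_def)
next
  case (3 x y)
  then show ?thesis using upper[of x y] by (simp add: upper_def)
next
  case (4 x y)
  then show ?thesis using lower[of x y] by (simp add: lower_def)
next
  case (5 x y)
  then show ?thesis using upper[of x y] by (simp add: upper_def insert_commute)
qed

lemma snub_tiles_members:
  "odd (i + j) \<Longrightarrow> square_cell i j \<in> snub_tiles"
  "even (i + j) \<Longrightarrow> lower i j \<in> snub_tiles"
  "even (i + j) \<Longrightarrow> upper i j \<in> snub_tiles"
  using snub_tileI[of i j] by (auto simp: square_cell_def lower_def upper_def insert_commute)

lemma square_tiles_iff:
  "square_cell i j \<in> square_tiles \<longleftrightarrow> odd (i + j)"
  "even (i + j) \<Longrightarrow> lower i j \<notin> square_tiles"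
  "even (i + j) \<Longrightarrow> upper i j \<notin> square_tiles"
  unfolding square_tiles_def
  by (auto dest: arg_cong[of _ _ corner])

text \<open>With the next two lemmas this prepares \<open>cairo_edge_cases\<close>: two distinct
  tiles sharing a side must be the two candidates listed for it.\<close>

lemma tiles_at_horizontal_edge:
  assumes "T \<in> snub_tiles" "{(x, y), (x + 1, y)} \<subseteq> T"
  shows "T \<in> (if even (x + y) then {lower x y, square_cell x (y - 1)}
    else {upper x (y - 1), square_cell x y})"
  using assms(1)
proof (cases rule: snub_tiles_shape_cases)
  case (square i j)
  then have "i = x \<and> (j = y \<or> j = y - 1)"
    using assms(2) by (auto simp: square_cell_def)
  then show ?thesis using square by auto
next
  case (lower i j)
  then have "i = x \<and> j = y"
    using assms(2) by (auto simp: lower_def split: if_splits)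
  then show ?thesis using lower by auto
next
  case (upper i j)
  then have "i = x \<and> j = y - 1"
    using assms(2) by (auto simp: upper_def split: if_splits)
  then show ?thesis using upper by auto
qed

lemma tiles_at_vertical_edge:
  assumes "T \<in> snub_tiles" "{(x, y), (x, y + 1)} \<subseteq> T"
  shows "T \<in> (if even (x + y) then {if even x then upper x y else lower x y, square_cell (x - 1) y}
    else {if odd x then lower (x - 1) y else upper (x - 1) y, square_cell x y})"
  using assms(1)
proof (cases rule: snub_tiles_shape_cases)
  case (square i j)
  then have "j = y \<and> (i = x \<or> i = x - 1)"
    using assms(2) by (auto simp: square_cell_def)
  then show ?thesis using square by auto
next
  case (lower i j)
  then have "j = y \<and> i = (if even i then x - 1 else x)"
    using assms(2) by (auto simp: lower_def split: if_splits)
  then show ?thesis using lower by (auto split: if_splits)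
next
  case (upper i j)
  then have "j = y \<and> i = (if even i then x else x - 1)"
    using assms(2) by (auto simp: upper_def split: if_splits)
  then show ?thesis using upper by (auto split: if_splits)
qed

lemma tiles_at_diagonal_edge:
  assumes "T \<in> snub_tiles" "even (x + y)"
    and "{(if even x then x else x + 1, y), (if even x then x + 1 else x, y + 1)} \<subseteq> T"
  shows "T \<in> {lower x y, upper x y}"
  using assms(1)
proof (cases rule: snub_tiles_shape_cases)
  case (square i j)
  then have "i = x \<and> j = y"
    using assms(3) by (auto simp: square_cell_def split: if_splits)
  then show ?thesis using square assms(2) by auto
next
  case (lower i j)
  then have "i = x \<and> j = y"
    using assms(2,3) by (auto simp: lower_def split: if_splits)
  then show ?thesis using lower by auto
next
  case (upper i j)
  then have "i = x \<and> j = y"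
    using assms(2,3) by (auto simp: upper_def split: if_splits)
  then show ?thesis using upper by auto
qed

text \<open>A diagonal separates the two triangles of a rhombus, and every other side separates a
  triangle from a square. So each edge is attached to a rhombus, and the triangles can be colored
  one rhombus at a time.\<close>

lemma cairo_edge_cases [consumes 1]:
  assumes "e \<in> edges cairo_lattice"
  obtains (lower_upper) i j where "even (i + j)" "e = {lower i j, upper i j}"
  | (lower_below) i j where "even (i + j)" "e = {lower i j, square_cell i (j - 1)}"
  | (lower_side) i j where "even (i + j)" "e = {lower i j, square_cell (i + turn i) j}"
  | (upper_side) i j where "even (i + j)" "e = {upper i j, square_cell (i - turn i) j}"
  | (upper_above) i j where "even (i + j)" "e = {upper i j, square_cell i (j + 1)}"
proof -
  obtain A B s where AB: "e = {A, B}" "A \<in> snub_tiles" "B \<in> snub_tiles" "A \<noteq> B"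
    and s: "s \<in> snub_edges" "s \<subseteq> A" "s \<subseteq> B"
    using assms unfolding cairo_lattice_def dual_graph_def by auto
  have pair: "{A, B} = {P, Q}" if "A \<in> {P, Q}" "B \<in> {P, Q}" for P Q
    using that AB(4) by auto
  from s(1) consider
      (h) x y where "s = {(x, y), (x + 1, y)}"
    | (v) x y where "s = {(x, y), (x, y + 1)}"
    | (rising) x y where "even x" "even y" "s = {(x, y), (x + 1, y + 1)}"
    | (falling) x y where "odd x" "odd y" "s = {(x + 1, y), (x, y + 1)}"
    unfolding snub_edges_def by blast
  then show thesis
  proof cases
    case h
    note T = tiles_at_horizontal_edge[OF AB(2) s(2)[unfolded h]]
      tiles_at_horizontal_edge[OF AB(3) s(3)[unfolded h]]
    show thesis
    proof (cases "even (x + y)")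
      case True
      then have "{A, B} = {lower x y, square_cell x (y - 1)}"
        using T by (intro pair) simp_all
      then show thesis using True AB(1) lower_below[of x y] by simp
    next
      case False
      then have "{A, B} = {upper x (y - 1), square_cell x y}"
        using T by (intro pair) simp_all
      then show thesis using False AB(1) upper_above[of x "y - 1"] by simp
    qed
  next
    case v
    note T = tiles_at_vertical_edge[OF AB(2) s(2)[unfolded v]]
      tiles_at_vertical_edge[OF AB(3) s(3)[unfolded v]]
    show thesis
    proof (cases "even (x + y)")
      case True
      then have "{A, B} = {if even x then upper x y else lower x y, square_cell (x - 1) y}"
        using T by (intro pair) simp_all
      then show thesis using True AB(1) lower_side[of x y] upper_side[of x y]
        by (cases "even x") (simp_all add: turn_def)
    next
      case False
      then have "{A, B} = {if odd x then lower (x - 1) y else upper (x - 1) y, square_cell x y}"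
        using T by (intro pair) simp_all
      then show thesis using False AB(1) lower_side[of "x - 1" y] upper_side[of "x - 1" y]
        by (cases "even x") (simp_all add: turn_def)
    qed
  next
    case rising
    then have "{A, B} = {lower x y, upper x y}"
      using tiles_at_diagonal_edge[of _ x y] AB(2,3) s(2,3) by (intro pair) simp_all
    then show thesis using rising AB(1) lower_upper[of x y] by simp
  next
    case falling
    then have "{A, B} = {lower x y, upper x y}"
      using tiles_at_diagonal_edge[of _ x y] AB(2,3) s(2,3) by (intro pair) simp_all
    then show thesis using falling AB(1) lower_upper[of x y] by simp
  qed
qed

lemma cairo_edgeI:
  assumes "A \<in> snub_tiles" "B \<in> snub_tiles" "A \<noteq> B" "s \<in> snub_edges" "s \<subseteq> A" "s \<subseteq> B"
  shows "{A, B} \<in> edges cairo_lattice"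
  using assms unfolding cairo_lattice_def dual_graph_def snd_conv by blast

lemma rhombus_square_edges_in_cairo:
  assumes "even (i + j)"
  shows "{lower i j, square_cell i (j - 1)} \<in> edges cairo_lattice"
    and "{lower i j, square_cell (i + turn i) j} \<in> edges cairo_lattice"
    and "{upper i j, square_cell (i - turn i) j} \<in> edges cairo_lattice"
    and "{upper i j, square_cell i (j + 1)} \<in> edges cairo_lattice"
proof -
  have neq: "A \<noteq> B" if "corner A \<noteq> corner B" for A B
    using that by auto
  have sq: "square_cell i (j - 1) \<in> snub_tiles" "square_cell (i + turn i) j \<in> snub_tiles"
      "square_cell (i - turn i) j \<in> snub_tiles" "square_cell i (j + 1) \<in> snub_tiles"
    using assms by (auto intro!: snub_tiles_members simp: turn_def)
  note low = snub_tiles_members(2)[OF assms] and up = snub_tiles_members(3)[OF assms]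
  show "{lower i j, square_cell i (j - 1)} \<in> edges cairo_lattice"
    by (rule cairo_edgeI[OF low sq(1) neq snub_edgeI(1)[of i j]], simp)
      (simp_all add: lower_def square_cell_def)
  show "{lower i j, square_cell (i + turn i) j} \<in> edges cairo_lattice"
    by (rule cairo_edgeI[OF low sq(2) neq snub_edgeI(2)[of "if even i then i + 1 else i" j]],
        simp add: turn_def) (simp_all add: lower_def square_cell_def turn_def)
  show "{upper i j, square_cell (i - turn i) j} \<in> edges cairo_lattice"
    by (rule cairo_edgeI[OF up sq(3) neq snub_edgeI(2)[of "if even i then i else i + 1" j]],
        simp add: turn_def) (simp_all add: upper_def square_cell_def turn_def)
  show "{upper i j, square_cell i (j + 1)} \<in> edges cairo_lattice"
    by (rule cairo_edgeI[OF up sq(4) neq snub_edgeI(1)[of i "j + 1"]], simp)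
      (simp_all add: upper_def square_cell_def)
qed

lemma vertex_degree_square_cell:
  assumes "odd (p + q)"
  shows "vertex_degree cairo_lattice (square_cell p q) = 4"
proof -
  let ?S = "square_cell p q"
  \<comment> \<open>The left side of a cut cell belongs to its upper triangle if the first index is
    even and to the lower one if it is odd; for the right side it is the other way round.\<close>
  let ?R = "if odd p then upper (p + 1) q else lower (p + 1) q"
  let ?L = "if odd p then lower (p - 1) q else upper (p - 1) q"
  let ?N = "{lower p (q + 1), upper p (q - 1), ?R, ?L}"
  have neq: "A \<noteq> B" if "corner A \<noteq> corner B" for A B
    using that by auto
  have "{e \<in> edges cairo_lattice. ?S \<in> e} = (\<lambda>T. {T, ?S}) ` ?N"
  proof (intro equalityI subsetI)
    fix e assume "e \<in> {e \<in> edges cairo_lattice. ?S \<in> e}"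
    then have e: "e \<in> edges cairo_lattice" "?S \<in> e" by simp_all
    have not_triangle: "?S \<noteq> lower i j" "?S \<noteq> upper i j" if "even (i + j)" for i j
      using assms that by (auto intro!: neq)
    have S_eq: "?S = square_cell p' q' \<longleftrightarrow> p = p' \<and> q = q'" for p' q'
      by (metis corner_simps(1) prod.inject)
    from e(1) show "e \<in> (\<lambda>T. {T, ?S}) ` ?N"
    proof (cases rule: cairo_edge_cases)
      case (lower_upper i j)
      then show ?thesis using e(2) not_triangle[of i j] by simp
    next
      case (lower_below i j)
      then have "p = i" "q = j - 1"
        using e(2) not_triangle[of i j] S_eq by simp_all
      then show ?thesis using lower_below by simp
    next
      case (lower_side i j)
      then have "p = i + turn i" "q = j"
        using e(2) not_triangle[of i j] S_eq by simp_all
      then show ?thesis using lower_side by (cases "even i") (simp_all add: turn_def)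
    next
      case (upper_side i j)
      then have "p = i - turn i" "q = j"
        using e(2) not_triangle[of i j] S_eq by simp_all
      then show ?thesis using upper_side by (cases "even i") (simp_all add: turn_def)
    next
      case (upper_above i j)
      then have "p = i" "q = j + 1"
        using e(2) not_triangle[of i j] S_eq by simp_all
      then show ?thesis using upper_above by simp
    qed
  next
    fix e assume "e \<in> (\<lambda>T. {T, ?S}) ` ?N"
    then obtain T where T: "T \<in> ?N" "e = {T, ?S}" by blast
    have "{lower p (q + 1), ?S} \<in> edges cairo_lattice" "{upper p (q - 1), ?S} \<in> edges cairo_lattice"
      using assms rhombus_square_edges_in_cairo(1)[of p "q + 1"]
        rhombus_square_edges_in_cairo(4)[of p "q - 1"] by simp_all
    moreover have "{?R, ?S} \<in> edges cairo_lattice"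
      using assms rhombus_square_edges_in_cairo(2,3)[of "p + 1" q]
      by (cases "even p") (simp_all add: turn_def)
    moreover have "{?L, ?S} \<in> edges cairo_lattice"
      using assms rhombus_square_edges_in_cairo(2,3)[of "p - 1" q]
      by (cases "even p") (simp_all add: turn_def)
    ultimately have "{T, ?S} \<in> edges cairo_lattice"
      using T(1) by (elim insertE emptyE) (simp_all only:)
    then show "e \<in> {e \<in> edges cairo_lattice. ?S \<in> e}"
      using T(2) by simp
  qed
  moreover have "inj_on (\<lambda>T. {T, ?S}) ?N"
    by (rule inj_onI) (metis doubleton_eq_iff)
  moreover have "card ?N = 4"
  proof -
    \<comment> \<open>The four neighbors lie in four different cells, which gives the lower bound on
      their number.\<close>
    have "corner ` ?N = {(p, q + 1), (p, q - 1), (p + 1, q), (p - 1, q)}"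
      by auto
    then have "card (corner ` ?N) = 4" by simp
    moreover have "card (corner ` ?N) \<le> card ?N" by (rule card_image_le) simp
    moreover have "card ?N \<le> 4"
      using card_length[of "[lower p (q + 1), upper p (q - 1), ?R, ?L]"] by simp
    ultimately show ?thesis by linarith
  qed
  ultimately show ?thesis unfolding vertex_degree_def by (simp only: card_image)
qed

section \<open>Colors for the two triangles of one rhombus\<close>

lemma ex2I: "P x y \<Longrightarrow> \<exists>x y. P x y"
  by blast

text \<open>
  The flag \<open>present\<close> says whether the square of color \<open>x\<close> belongs to the subgraph at all.
\<close>

definition fits :: "int \<Rightarrow> bool \<Rightarrow> bool \<Rightarrow> int \<Rightarrow> int \<Rightarrow> bool" where
  "fits t present near x z \<longleftrightarrow> (present \<longrightarrow> (\<bar>z - x\<bar> \<le> t \<longleftrightarrow> near))"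

text \<open>Every color in \<open>{m + 1..2 * m}\<close> is within \<open>m\<close> of all of
  \<open>{m..2 * m + 1}\<close> and at distance at least \<open>m + 1\<close> from \<open>0\<close>
  and \<open>3 * m + 1\<close>.\<close>

lemma triangle_colors:
  fixes m xa xb :: int
  assumes "0 \<le> m"
    and "pa \<longrightarrow> m < xa \<and> xa \<le> 2 * m"
    and "pb \<longrightarrow> m < xb \<and> xb \<le> 2 * m"
    and "pa \<longrightarrow> pb \<longrightarrow> xa \<noteq> xb"
  obtains (near) "\<forall>z\<in>{m..2 * m + 1}. fits m pa na xa z \<and> fits m pb nb xb z"
  | (far) "\<forall>z\<in>{0, 3 * m + 1}. fits m pa na xa z \<and> fits m pb nb xb z"
  | (low) z where "pa" "pb" "(xa < xb) = na" "z \<in> {1..m}" "fits m pa na xa z" "fits m pb nb xb z"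
  | (high) z where "pa" "pb" "(xa < xb) \<noteq> na" "z \<in> {2 * m + 1..3 * m}"
      "fits m pa na xa z" "fits m pb nb xb z"
proof -
  \<comment> \<open>An absent square counts as carrying either label, so mixed labels occur only
    with both squares present.\<close>
  consider "pa \<longrightarrow> na" "pb \<longrightarrow> nb" | "pa \<longrightarrow> \<not> na" "pb \<longrightarrow> \<not> nb"
    | "pa" "pb" "na" "\<not> nb" | "pa" "pb" "\<not> na" "nb"
    by blast
  then show thesis
  proof cases
    case 1
    with assms show thesis by (intro near) (auto simp: fits_def)
  next
    case 2
    with assms show thesis by (intro far) (auto simp: fits_def)
  next
    case 3
    then show thesis
      \<comment> \<open>The witness is at distance exactly \<open>m\<close> from the square labeled
        \<open>N\<close>, on the side away from the other square, which is therefore too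
        far.\<close>
      using low[of "xa - m"] high[of "xa + m"] assms
      by (cases "xa < xb") (auto simp: fits_def)
  next
    case 4
    then show thesis
      using low[of "xb - m"] high[of "xb + m"] assms
      by (cases "xa < xb") (auto simp: fits_def)
  qed
qed

text \<open>A triangle that is not mixed can adapt to its partner: \<open>m\<close> and
  \<open>0\<close> are within \<open>m\<close> of every low color, \<open>2 * m + 1\<close> and
  \<open>3 * m + 1\<close> are not, and symmetrically for high colors. Two mixed triangles leave no
  such choice: they are near iff both are low or both are high, and \<open>coupled\<close> demands
  just this.\<close>

lemma rhombus_colors:
  fixes m xa xb xc xd :: int
  assumes m: "0 \<le> m"
    and a: "pa \<longrightarrow> m < xa \<and> xa \<le> 2 * m"
    and b: "pb \<longrightarrow> m < xb \<and> xb \<le> 2 * m"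
    and c: "pc \<longrightarrow> m < xc \<and> xc \<le> 2 * m"
    and d: "pd \<longrightarrow> m < xd \<and> xd \<le> 2 * m"
    and ab: "pa \<longrightarrow> pb \<longrightarrow> xa \<noteq> xb"
    and cd: "pc \<longrightarrow> pd \<longrightarrow> xc \<noteq> xd"
    and coupled: "pa \<Longrightarrow> pb \<Longrightarrow> pc \<Longrightarrow> pd \<Longrightarrow>
      (((xa < xb) = na) = ((xc < xd) = nc)) = near"
  obtains u v where "u \<in> {0..3 * m + 1}" "v \<in> {0..3 * m + 1}"
    "fits m pa na xa u" "fits m pb nb xb u" "fits m pc nc xc v" "fits m pd nd xd v"
    "\<bar>u - v\<bar> \<le> m \<longleftrightarrow> near"
proof -
  let ?U = "\<lambda>z. fits m pa na xa z \<and> fits m pb nb xb z"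
  let ?V = "\<lambda>z. fits m pc nc xc z \<and> fits m pd nd xd z"
  have "\<exists>u v. u \<in> {0..3 * m + 1} \<and> v \<in> {0..3 * m + 1} \<and> ?U u \<and> ?V v \<and> (\<bar>u - v\<bar> \<le> m \<longleftrightarrow> near)"
  proof (cases rule: triangle_colors[OF m a b ab, where na = na and nb = nb])
    case U: 1
    show ?thesis
    proof (cases rule: triangle_colors[OF m c d cd, where na = nc and nb = nd])
      case 1
      then show ?thesis using U m
        by (intro ex2I[of _ m "if near then m else 2 * m + 1"]) auto
    next
      case 2
      then show ?thesis using U m
        by (intro ex2I[of _ "if near then m else m + 1" 0]) auto
    next
      case (3 z)
      then show ?thesis using U m
        by (intro ex2I[of _ "if near then m else 2 * m + 1" z]) auto
    next
      case (4 z)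
      then show ?thesis using U m
        by (intro ex2I[of _ "if near then 2 * m + 1 else m" z]) auto
    qed
  next
    case U: 2
    show ?thesis
    proof (cases rule: triangle_colors[OF m c d cd, where na = nc and nb = nd])
      case 1
      then show ?thesis using U m
        by (intro ex2I[of _ 0 "if near then m else m + 1"]) auto
    next
      case 2
      then show ?thesis using U m
        by (intro ex2I[of _ 0 "if near then 0 else 3 * m + 1"]) auto
    next
      case (3 z)
      then show ?thesis using U m
        by (intro ex2I[of _ "if near then 0 else 3 * m + 1" z]) auto
    next
      case (4 z)
      then show ?thesis using U m
        by (intro ex2I[of _ "if near then 3 * m + 1 else 0" z]) auto
    qed
  next
    case U: (3 u)
    show ?thesis
    proof (cases rule: triangle_colors[OF m c d cd, where na = nc and nb = nd])
      case 1
      then show ?thesis using U m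
        by (intro ex2I[of _ u "if near then m else 2 * m + 1"]) auto
    next
      case 2
      then show ?thesis using U m
        by (intro ex2I[of _ u "if near then 0 else 3 * m + 1"]) auto
    next
      case (3 z)
      then show ?thesis using U m coupled
        by (intro ex2I[of _ u z]) auto
    next
      case (4 z)
      then show ?thesis using U m coupled
        by (intro ex2I[of _ u z]) auto
    qed
  next
    case U: (4 u)
    show ?thesis
    proof (cases rule: triangle_colors[OF m c d cd, where na = nc and nb = nd])
      case 1
      then show ?thesis using U m
        by (intro ex2I[of _ u "if near then 2 * m + 1 else m"]) auto
    next
      case 2
      then show ?thesis using U m
        by (intro ex2I[of _ u "if near then 3 * m + 1 else 0"]) auto
    next
      case (3 z)
      then show ?thesis using U m coupled
        by (intro ex2I[of _ u z]) auto
    next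
      case (4 z)
      then show ?thesis using U m coupled
        by (intro ex2I[of _ u z]) auto
    qed
  qed
  then show thesis using that by blast
qed

section \<open>Assembly of the coloring\<close>

text \<open>Ranks turn the real potential into integers in \<open>{1..card S}\<close> with the same
  order. Equal potentials share a rank, which is harmless since only squares next to a common
  triangle must differ.\<close>

lemma card_rank:
  fixes k :: "'a \<Rightarrow> 'b::linorder"
  assumes "finite S" "a \<in> S" "b \<in> S"
  shows "0 < card {s \<in> S. k s \<le> k a}" "card {s \<in> S. k s \<le> k a} \<le> card S"
    and "card {s \<in> S. k s \<le> k a} < card {s \<in> S. k s \<le> k b} \<longleftrightarrow> k a < k b"
proof -
  show "0 < card {s \<in> S. k s \<le> k a}"
    using assms by (auto simp: card_gt_0_iff)
  show "card {s \<in> S. k s \<le> k a} \<le> card S"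
    using assms by (intro card_mono) auto
  show "card {s \<in> S. k s \<le> k a} < card {s \<in> S. k s \<le> k b} \<longleftrightarrow> k a < k b"
  proof
    assume "k a < k b"
    then have "{s \<in> S. k s \<le> k a} \<subset> {s \<in> S. k s \<le> k b}"
      using assms(3) by force
    then show "card {s \<in> S. k s \<le> k a} < card {s \<in> S. k s \<le> k b}"
      using assms(1) by (intro psubset_card_mono) auto
  next
    assume *: "card {s \<in> S. k s \<le> k a} < card {s \<in> S. k s \<le> k b}"
    show "k a < k b"
    proof (rule ccontr)
      assume "\<not> k a < k b"
      then have "card {s \<in> S. k s \<le> k b} \<le> card {s \<in> S. k s \<le> k a}"
        using assms(1) by (intro card_mono) auto
      with * show False by simp
    qed
  qed
qed

lemma threshold_coloringI:
  assumes "0 \<le> t"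
    and "\<And>e. e \<in> edges G \<Longrightarrow> \<exists>u v. e = {u, v} \<and> (\<bar>c u - c v\<bar> \<le> t \<longleftrightarrow> l e = N)"
  shows "threshold_coloring G l t c"
  unfolding threshold_coloring_def
proof (intro conjI allI impI assms(1))
  fix u v assume "{u, v} \<in> edges G"
  then obtain u' v' where "{u, v} = {u', v'}" "\<bar>c u' - c v'\<bar> \<le> t \<longleftrightarrow> l {u, v} = N"
    using assms(2) by blast
  then show "\<bar>c u - c v\<bar> \<le> t \<longleftrightarrow> l {u, v} = N"
    by (auto simp: doubleton_eq_iff abs_minus_commute)
qed

theorem mainTheorem6:
  fixes G :: "(int \<times> int) set graph" and m :: nat
  assumes "induced_subgraph G cairo_lattice"
    and "finite (verts G)"
    and "m = card {v \<in> verts G. vertex_degree cairo_lattice v = 4}"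
  shows "total_threshold_colorable G (3 * int m + 2) (int m)"
  unfolding total_threshold_colorable_def
proof
  fix l :: "(int \<times> int) set set \<Rightarrow> label"
  let ?a = "\<lambda>i j. square_cell i (j - 1)" and ?b = "\<lambda>i j. square_cell (i + turn i) j"
  let ?c = "\<lambda>i j. square_cell (i - turn i) j" and ?d = "\<lambda>i j. square_cell i (j + 1)"
  let ?near = "\<lambda>A B. l {A, B} = N"
  define S where "S = verts G \<inter> square_tiles"
  have "finite S" using assms(2) by (simp add: S_def)
  \<comment> \<open>Every square tile is a 4-vertex of the lattice.\<close>
  have "card S \<le> m"
    unfolding assms(3) using assms(2)
    by (intro card_mono) (auto simp: S_def square_tiles_def vertex_degree_square_cell)
  \<comment> \<open>Equality of truth values is associative and commutative, so the parity chosen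
    here is the hypothesis \<open>coupled\<close> solved for the order of the first two squares.
    Labels off the edges of \<open>G\<close> just contribute arbitrary conditions.\<close>
  obtain k :: "int \<times> int \<Rightarrow> real" where k:
    "\<And>i j. even (i + j) \<Longrightarrow> k (i, j - 1) \<noteq> k (i + turn i, j)"
    "\<And>i j. even (i + j) \<Longrightarrow> k (i - turn i, j) \<noteq> k (i, j + 1)"
    "\<And>i j. even (i + j) \<Longrightarrow> k (i, j - 1) < k (i + turn i, j) \<longleftrightarrow>
       (k (i - turn i, j) < k (i, j + 1)) =
       (?near (lower i j) (?a i j) = (?near (upper i j) (?c i j) = ?near (lower i j) (upper i j)))"
    using square_potential[of "\<lambda>i j. ?near (lower i j) (?a i j) =
        (?near (upper i j) (?c i j) = ?near (lower i j) (upper i j))"] by blast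
  define x where "x A = int m + int (card {B \<in> S. k (corner B) \<le> k (corner A)})" for A
  have x_range: "int m < x A \<and> x A \<le> 2 * int m" if "A \<in> S" for A
    using card_rank(1,2)[OF \<open>finite S\<close> that that, of "\<lambda>A. k (corner A)"] \<open>card S \<le> m\<close>
    by (simp add: x_def)
  have x_less: "x A < x B \<longleftrightarrow> k (corner A) < k (corner B)" if "A \<in> S" "B \<in> S" for A B
    using card_rank(3)[OF \<open>finite S\<close> that, of "\<lambda>A. k (corner A)"] by (simp add: x_def)
  have x_neq: "x A \<noteq> x B" if "A \<in> S" "B \<in> S" "k (corner A) \<noteq> k (corner B)" for A B
    using x_less[OF that(1,2)] x_less[OF that(2,1)] that(3) by linarith
  \<comment> \<open>Triangles are colored in every rhombus, inside \<open>G\<close> or not. Squares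
    outside \<open>S\<close> are masked because \<open>x\<close> is controlled only on
    \<open>S\<close>.\<close>
  define good where "good i j u v \<longleftrightarrow> u \<in> {0..3 * int m + 1} \<and> v \<in> {0..3 * int m + 1} \<and>
      fits m (?a i j \<in> S) (?near (lower i j) (?a i j)) (x (?a i j)) u \<and>
      fits m (?b i j \<in> S) (?near (lower i j) (?b i j)) (x (?b i j)) u \<and>
      fits m (?c i j \<in> S) (?near (upper i j) (?c i j)) (x (?c i j)) v \<and>
      fits m (?d i j \<in> S) (?near (upper i j) (?d i j)) (x (?d i j)) v \<and>
      (\<bar>u - v\<bar> \<le> int m \<longleftrightarrow> ?near (lower i j) (upper i j))" for i j u v
  have "\<exists>u v. even (i + j) \<longrightarrow> good i j u v" for i j
  proof (cases "even (i + j)")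
    case True
    show ?thesis
    proof (rule rhombus_colors[of "int m" "?a i j \<in> S" "x (?a i j)" "?b i j \<in> S" "x (?b i j)"
          "?c i j \<in> S" "x (?c i j)" "?d i j \<in> S" "x (?d i j)"
          "?near (lower i j) (?a i j)" "?near (upper i j) (?c i j)" "?near (lower i j) (upper i j)"
          "?near (lower i j) (?b i j)" "?near (upper i j) (?d i j)"])
      assume "?a i j \<in> S" "?b i j \<in> S" "?c i j \<in> S" "?d i j \<in> S"
      then have "x (?a i j) < x (?b i j) \<longleftrightarrow> k (i, j - 1) < k (i + turn i, j)"
        "x (?c i j) < x (?d i j) \<longleftrightarrow> k (i - turn i, j) < k (i, j + 1)"
        by (simp_all add: x_less)
      then show "(((x (?a i j) < x (?b i j)) = ?near (lower i j) (?a i j)) =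
          ((x (?c i j) < x (?d i j)) = ?near (upper i j) (?c i j))) =
          ?near (lower i j) (upper i j)"
        using k(3)[OF True] by argo
    next
      fix u v
      assume "u \<in> {0..3 * int m + 1}" "v \<in> {0..3 * int m + 1}"
        "fits m (?a i j \<in> S) (?near (lower i j) (?a i j)) (x (?a i j)) u"
        "fits m (?b i j \<in> S) (?near (lower i j) (?b i j)) (x (?b i j)) u"
        "fits m (?c i j \<in> S) (?near (upper i j) (?c i j)) (x (?c i j)) v"
        "fits m (?d i j \<in> S) (?near (upper i j) (?d i j)) (x (?d i j)) v"
        "\<bar>u - v\<bar> \<le> int m \<longleftrightarrow> ?near (lower i j) (upper i j)"
      then show ?thesis unfolding good_def by blast
    qed (use True k(1,2)[of i j] x_range in \<open>simp_all add: x_neq\<close>)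
  qed simp
  then obtain \<alpha> \<beta> where good: "\<And>i j. even (i + j) \<Longrightarrow> good i j (\<alpha> i j) (\<beta> i j)"
    by metis
  \<comment> \<open>On triangles \<open>corner\<close> returns the index of the rhombus.\<close>
  define c where "c A = (if A \<in> square_tiles then x A
      else case corner A of (i, j) \<Rightarrow> if A = lower i j then \<alpha> i j else \<beta> i j)" for A
  have c_square: "c A = x A" if "A \<in> square_tiles" for A
    using that by (simp add: c_def)
  have c_lower: "c (lower i j) = \<alpha> i j" and c_upper: "c (upper i j) = \<beta> i j"
    if "even (i + j)" for i j
    using that lower_neq_upper[of i j] by (simp_all add: c_def square_tiles_iff)
  have c_range: "0 \<le> c A \<and> c A \<le> 3 * int m + 1" if "A \<in> verts G" for A
  proof -
    have "A \<in> snub_tiles"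
      using that assms(1) by (auto simp: induced_subgraph_def cairo_lattice_def dual_graph_def)
    then show ?thesis
    proof (cases rule: snub_tiles_shape_cases)
      case (square i j)
      then have "A \<in> square_tiles" by (simp add: square_tiles_iff)
      then show ?thesis using x_range[of A] that by (simp add: S_def c_square)
    next
      case (lower i j)
      then show ?thesis using good[of i j] by (simp add: c_lower good_def)
    next
      case (upper i j)
      then show ?thesis using good[of i j] by (simp add: c_upper good_def)
    qed
  qed
  have "threshold_coloring G l m c"
  proof (rule threshold_coloringI)
    fix e assume "e \<in> edges G"
    then have e: "e \<in> edges cairo_lattice" "e \<subseteq> verts G"
      using assms(1) by (auto simp: induced_subgraph_def)
    \<comment> \<open>The ends of \<open>e\<close> are vertices of \<open>G\<close>, so the guard in
      \<open>fits\<close> holds for a square on \<open>e\<close>.\<close>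
    have S: "A \<in> S" if "A \<in> e" "A \<in> square_tiles" for A
      using that e(2) by (auto simp: S_def)
    have squares: "?a i j \<in> square_tiles" "?b i j \<in> square_tiles"
        "?c i j \<in> square_tiles" "?d i j \<in> square_tiles" if "even (i + j)" for i j
      using that by (simp_all add: square_tiles_iff turn_def)
    from e(1) show "\<exists>u v. e = {u, v} \<and> (\<bar>c u - c v\<bar> \<le> int m \<longleftrightarrow> l e = N)"
    proof (cases rule: cairo_edge_cases)
      case (lower_upper i j)
      show ?thesis
        using good[OF lower_upper(1)]
        by (intro ex2I[of _ "lower i j" "upper i j"])
          (simp add: lower_upper(2) c_lower[OF lower_upper(1)] c_upper[OF lower_upper(1)] good_def)
    next
      case (lower_below i j)
      then show ?thesis
        using good[OF lower_below(1)] S[of "?a i j"] squares(1)[OF lower_below(1)]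
        by (intro ex2I[of _ "lower i j" "?a i j"])
          (simp add: c_lower[OF lower_below(1)] c_square good_def fits_def)
    next
      case (lower_side i j)
      then show ?thesis
        using good[OF lower_side(1)] S[of "?b i j"] squares(2)[OF lower_side(1)]
        by (intro ex2I[of _ "lower i j" "?b i j"])
          (simp add: c_lower[OF lower_side(1)] c_square good_def fits_def)
    next
      case (upper_side i j)
      then show ?thesis
        using good[OF upper_side(1)] S[of "?c i j"] squares(3)[OF upper_side(1)]
        by (intro ex2I[of _ "upper i j" "?c i j"])
          (simp add: c_upper[OF upper_side(1)] c_square good_def fits_def)
    next
      case (upper_above i j)
      then show ?thesis
        using good[OF upper_above(1)] S[of "?d i j"] squares(4)[OF upper_above(1)]
        by (intro ex2I[of _ "upper i j" "?d i j"])
          (simp add: c_upper[OF upper_above(1)] c_square good_def fits_def)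
    qed
  qed simp
  moreover have "Max (c ` verts G) - Min (c ` verts G) < 3 * int m + 2" if "verts G \<noteq> {}"
  proof -
    have "Max (c ` verts G) \<in> c ` verts G" "Min (c ` verts G) \<in> c ` verts G"
      using that assms(2) by (simp_all add: Max_in Min_in)
    then obtain A B where "A \<in> verts G" "B \<in> verts G"
      "Max (c ` verts G) = c A" "Min (c ` verts G) = c B"
      by blast
    then show ?thesis using c_range[of A] c_range[of B] by linarith
  qed
  ultimately show "\<exists>c. rt_threshold_coloring G l (3 * int m + 2) (int m) c"
    unfolding rt_threshold_coloring_def by blast
qed

end
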